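(* Let $\mathcal{S}$ be a commutative semiring with $0$ and $1$ and let $n\geq 1$. The following are equivalent: (i) the semigroup variety (or the monoid variety) generated by $UT_n(\mathcal{S})$ is locally finite; (ii) $\mathcal{S}$ satisfies a multiplicative identity not implied by commutativity; (iii) $\mathcal{S}$ satisfies a multiplicative torsion identity, that is, an identity of the form $A^i=A^j$ with $i<j$. (The equivalence holds both when (i) is read for the semigroup variety and when (i) is read for the monoid variety.)
   Context: Semirings have associative operations $+$ and $\times$, with $+$ commutative, $\times$ distributing over $+$, $0\neq 1$, $1$ a multiplicative identity, and $0$ an additive identity and multiplicative zero; commutative means multiplication is commutative. $UT_n(\mathcal{S})$ is the monoid of $n\times n$ upper triangular matrices over $\mathcal{S}$ under matrix multiplication. A variety of semigroups (resp. monoids) is locally finite if every finitely generated semigroup (resp. monoid) in it is finite. A multiplicative identity of $\mathcal{S}$ is a semigroup or monoid identity $u=v$ ($u,v$ words over some alphabet) satisfied by the multiplicative monoid of $\mathcal{S}$ for all assignments of elements of $\mathcal{S}$ to the letters; it is not implied by commutativity if some letter occurs a different number of times in $u$ and in $v$. *)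

theory Defs
  imports "Jordan_Normal_Form.Matrix"
begin

text \<open>Semigroups are carried by the \<open>monoid\<close> record of HOL-Algebra; its field \<open>one\<close> plays no
  role in any of the semigroup notions below.\<close>

locale semigroup_structure =
  fixes G (structure)
  assumes m_closed: "\<lbrakk>x \<in> carrier G; y \<in> carrier G\<rbrakk> \<Longrightarrow> x \<otimes> y \<in> carrier G"
    and m_assoc: "\<lbrakk>x \<in> carrier G; y \<in> carrier G; z \<in> carrier G\<rbrakk>
                    \<Longrightarrow> (x \<otimes> y) \<otimes> z = x \<otimes> (y \<otimes> z)"

text \<open>Words are lists over the countable alphabet \<open>nat\<close>, which suffices because an identity
  involves finitely many letters. In a semigroup only nonempty words have a value.\<close>

fun semigroup_word_value :: "('b, 'c) monoid_scheme \<Rightarrow> (nat \<Rightarrow> 'b) \<Rightarrow> nat list \<Rightarrow> 'b" where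
  "semigroup_word_value G \<phi> [] = undefined"
| "semigroup_word_value G \<phi> [x] = \<phi> x"
| "semigroup_word_value G \<phi> (x # y # w) = \<phi> x \<otimes>\<^bsub>G\<^esub> semigroup_word_value G \<phi> (y # w)"

fun monoid_word_value :: "('b, 'c) monoid_scheme \<Rightarrow> (nat \<Rightarrow> 'b) \<Rightarrow> nat list \<Rightarrow> 'b" where
  "monoid_word_value G \<phi> [] = \<one>\<^bsub>G\<^esub>"
| "monoid_word_value G \<phi> (x # w) = \<phi> x \<otimes>\<^bsub>G\<^esub> monoid_word_value G \<phi> w"

definition satisfies_semigroup_identity ::
    "('b, 'c) monoid_scheme \<Rightarrow> nat list \<Rightarrow> nat list \<Rightarrow> bool" where
  "satisfies_semigroup_identity G u v \<longleftrightarrow> u \<noteq> [] \<and> v \<noteq> [] \<and>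
     (\<forall>\<phi> \<in> UNIV \<rightarrow> carrier G. semigroup_word_value G \<phi> u = semigroup_word_value G \<phi> v)"

definition satisfies_monoid_identity ::
    "('b, 'c) monoid_scheme \<Rightarrow> nat list \<Rightarrow> nat list \<Rightarrow> bool" where
  "satisfies_monoid_identity G u v \<longleftrightarrow>
     (\<forall>\<phi> \<in> UNIV \<rightarrow> carrier G. monoid_word_value G \<phi> u = monoid_word_value G \<phi> v)"

text \<open>A variety is an equational class, so the variety generated by \<open>M\<close> consists of the structures
  satisfying every identity of \<open>M\<close>. A HOL set only collects those with carrier in a fixed type
  \<open>'b\<close>. Since finitely generated semigroups and monoids are countable, every infinite \<open>'b\<close>
  contains a copy of each finitely generated member of the variety.\<close>

definition semigroup_variety :: "('a, 'c) monoid_scheme \<Rightarrow> 'b monoid set" where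
  "semigroup_variety M = {G. semigroup_structure G \<and>
     (\<forall>u v. satisfies_semigroup_identity M u v \<longrightarrow> satisfies_semigroup_identity G u v)}"

definition monoid_variety :: "('a, 'c) monoid_scheme \<Rightarrow> 'b monoid set" where
  "monoid_variety M = {G. Group.monoid G \<and>
     (\<forall>u v. satisfies_monoid_identity M u v \<longrightarrow> satisfies_monoid_identity G u v)}"

inductive_set semigroup_generate :: "('b, 'c) monoid_scheme \<Rightarrow> 'b set \<Rightarrow> 'b set"
  for G and X where
    incl: "x \<in> X \<Longrightarrow> x \<in> semigroup_generate G X"
  | mult: "\<lbrakk>x \<in> semigroup_generate G X; y \<in> semigroup_generate G X\<rbrakk>
             \<Longrightarrow> x \<otimes>\<^bsub>G\<^esub> y \<in> semigroup_generate G X"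

inductive_set monoid_generate :: "('b, 'c) monoid_scheme \<Rightarrow> 'b set \<Rightarrow> 'b set"
  for G and X where
    one: "\<one>\<^bsub>G\<^esub> \<in> monoid_generate G X"
  | incl: "x \<in> X \<Longrightarrow> x \<in> monoid_generate G X"
  | mult: "\<lbrakk>x \<in> monoid_generate G X; y \<in> monoid_generate G X\<rbrakk>
             \<Longrightarrow> x \<otimes>\<^bsub>G\<^esub> y \<in> monoid_generate G X"

definition locally_finite_semigroup_class :: "'b monoid set \<Rightarrow> bool" where
  "locally_finite_semigroup_class \<V> \<longleftrightarrow>
     (\<forall>G \<in> \<V>. (\<exists>X. finite X \<and> X \<subseteq> carrier G \<and> semigroup_generate G X = carrier G)
               \<longrightarrow> finite (carrier G))"

definition locally_finite_monoid_class :: "'b monoid set \<Rightarrow> bool" where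
  "locally_finite_monoid_class \<V> \<longleftrightarrow>
     (\<forall>G \<in> \<V>. (\<exists>X. finite X \<and> X \<subseteq> carrier G \<and> monoid_generate G X = carrier G)
               \<longrightarrow> finite (carrier G))"

definition UT :: "nat \<Rightarrow> 'a::semiring_1 mat monoid" where
  "UT n = \<lparr>carrier = {A \<in> carrier_mat n n. upper_triangular A}, mult = (*), one = 1\<^sub>m n\<rparr>"

definition multiplicative_monoid :: "'a::comm_semiring_1 monoid" where
  "multiplicative_monoid = \<lparr>carrier = UNIV, mult = (*), one = 1\<rparr>"

text \<open>Monoid identities subsume semigroup identities here: on nonempty words the two notions of
  value agree in a monoid.\<close>

definition satisfies_identity_beyond_commutativity :: "'a::comm_semiring_1 itself \<Rightarrow> bool" where
  "satisfies_identity_beyond_commutativity _ \<longleftrightarrow>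
     (\<exists>u v. satisfies_monoid_identity (multiplicative_monoid :: 'a monoid) u v \<and>
            (\<exists>x. count_list u x \<noteq> count_list v x))"

definition satisfies_torsion_identity :: "'a::comm_semiring_1 itself \<Rightarrow> bool" where
  "satisfies_torsion_identity _ \<longleftrightarrow> (\<exists>i j. i < j \<and> (\<forall>A::'a. A ^ i = A ^ j))"

end

theory Submission
  imports Defs "HOL-Library.Countable_Set" "HOL-Library.Function_Algebras"
begin

text \<open>
  Write \<open>S\<close> for the semiring. Setting all letters but one to \<open>1\<close> turns an identity beyond
  commutativity into a torsion identity (\<open>beyond_commutativity_iff_torsion\<close>).

  If \<open>S\<close> satisfies only identities implied by commutativity, then so does \<open>UT\<^sub>n(S)\<close>, because \<open>S\<close>
  embeds in it as the scalar matrices (\<open>multiplicative_identity_of_UT_identity\<close>). The additive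
  monoid of the natural numbers therefore lies in both varieties; it is finitely generated and
  infinite, so neither variety is locally finite.

  The substance is that torsion implies local finiteness. A commutative semiring satisfying
  \<open>A\<^sup>i = A\<^sup>j\<close> with \<open>i < j\<close> is locally finite: finitely many elements have only finitely many
  products by torsion, and the instance \<open>2\<^sup>i = 2\<^sup>j\<close> makes every element torsion for the addition
  as well, so that these products have only finitely many sums (\<open>subsemiring_of_torsion_finite\<close>).
  Local finiteness of the variety needs a bound that is uniform over all substitutions of matrices
  for letters. It is obtained by working with generic matrices, whose entries are the coordinate
  functions on the set of all substitutions. Functions with values in \<open>S\<close> again form a commutative
  semiring satisfying \<open>A\<^sup>i = A\<^sup>j\<close>. Hence the entries of products of finitely many generic matrices
  come from a finite set, and words in finitely many letters fall into finitely many classes modulo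
  the identities of \<open>UT\<^sub>n(S)\<close> (\<open>UT_words_finite_index\<close>). A finitely generated member of the
  variety is the image of such a finite set of classes.
\<close>

section \<open>Commutative monoids generated by torsion elements\<close>

lemma (in Group.monoid) monoid_generate_closed:
  assumes "X \<subseteq> carrier G" "a \<in> monoid_generate G X"
  shows "a \<in> carrier G"
  using assms(2) by induction (use assms(1) in auto)

lemma (in Group.monoid) finite_monoid_generate_singleton:
  assumes x: "x \<in> carrier G" and "i < j" and torsion: "x [^] i = x [^] (j::nat)"
  shows "finite (monoid_generate G {x})"
proof -
  \<comment> \<open>An exponent \<open>m \<ge> j\<close> may be lowered by the period \<open>j - i\<close>.\<close>
  have reduce: "x [^] m \<in> (\<lambda>r. x [^] r) ` {..<j}" for m :: nat
  proof (induction m rule: less_induct)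
    case (less m)
    show ?case
    proof (cases "m < j")
      case False
      have "x [^] m = x [^] (m - j) \<otimes> x [^] j"
        using x False by (simp add: nat_pow_mult)
      also have "\<dots> = x [^] (m - j + i)"
        using x by (simp add: nat_pow_mult flip: torsion)
      finally show ?thesis
        using less.IH[of "m - j + i"] False \<open>i < j\<close> by simp
    qed simp
  qed
  have "\<exists>m::nat. a = x [^] m" if "a \<in> monoid_generate G {x}" for a
    using that
  proof induction
    case one
    have "\<one> = x [^] (0::nat)" by simp
    then show ?case by blast
  next
    case (incl y)
    then have "y = x [^] (1::nat)" using x by simp
    then show ?case by blast
  next
    case (mult y z)
    then show ?case using x by (metis nat_pow_mult)
  qed
  then have "monoid_generate G {x} \<subseteq> (\<lambda>r. x [^] r) ` {..<j}"
    using reduce by blast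
  then show ?thesis by (rule finite_subset) simp
qed

text \<open>By commutativity an element generated by \<open>insert x X\<close> splits into a power of \<open>x\<close> and an
  element generated by \<open>X\<close>, so that the generators can be added one at a time.\<close>

lemma (in Group.comm_monoid) finite_monoid_generate:
  assumes "finite X" "X \<subseteq> carrier G"
    and "\<And>x. x \<in> X \<Longrightarrow> finite (monoid_generate G {x})"
  shows "finite (monoid_generate G X)"
  using assms
proof (induction X)
  case empty
  have "a = \<one>" if "a \<in> monoid_generate G {}" for a
    using that by induction auto
  then have "monoid_generate G {} \<subseteq> {\<one>}" by blast
  then show ?case by (rule finite_subset) simp
next
  case (insert x X)
  let ?P = "monoid_generate G {x}" and ?Q = "monoid_generate G X"
  have P: "?P \<subseteq> carrier G" and Q: "?Q \<subseteq> carrier G"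
    using monoid_generate_closed insert.prems by blast+
  have "\<exists>p\<in>?P. \<exists>q\<in>?Q. a = p \<otimes> q" if "a \<in> monoid_generate G (insert x X)" for a
    using that
  proof induction
    case one
    show ?case
      by (intro bexI[of _ \<one>]) (auto intro: monoid_generate.one)
  next
    case (incl y)
    then consider "y = x" | "y \<in> X" by blast
    then show ?case
    proof cases
      case 1
      then show ?thesis using insert.prems
        by (intro bexI[of _ x] bexI[of _ \<one>]) (auto intro: monoid_generate.intros)
    next
      case 2
      then show ?thesis using insert.prems
        by (intro bexI[of _ y] bexI[of _ \<one>]) (auto intro: monoid_generate.intros)
    qed
  next
    case (mult y z)
    then obtain p q p' q' where *: "p \<in> ?P" "q \<in> ?Q" "y = p \<otimes> q" "p' \<in> ?P" "q' \<in> ?Q" "z = p' \<otimes> q'"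
      by blast
    then have "y \<otimes> z = (p \<otimes> p') \<otimes> (q \<otimes> q')"
      using P Q by (simp add: subset_iff m_ac)
    with * show ?case by (meson monoid_generate.mult)
  qed
  then have "monoid_generate G (insert x X) \<subseteq> (\<lambda>(p, q). p \<otimes> q) ` (?P \<times> ?Q)"
    by fast
  moreover have "finite (?P \<times> ?Q)"
    using insert by auto
  ultimately show ?case
    by (meson finite_imageI finite_subset)
qed

section \<open>Commutative semirings with a torsion identity are locally finite\<close>

definition additive_monoid :: "'a::comm_monoid_add monoid" where
  "additive_monoid = \<lparr>carrier = UNIV, mult = (+), one = 0\<rparr>"

lemma comm_monoid_multiplicative: "Group.comm_monoid (multiplicative_monoid :: 'a::comm_semiring_1 monoid)"
  by unfold_locales (auto simp: multiplicative_monoid_def Units_def ac_simps)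

lemma comm_monoid_additive: "Group.comm_monoid (additive_monoid :: 'a::comm_monoid_add monoid)"
  by unfold_locales (auto simp: additive_monoid_def Units_def ac_simps)

lemma pow_multiplicative: "x [^]\<^bsub>multiplicative_monoid\<^esub> (m::nat) = (x::'a::comm_semiring_1) ^ m"
  by (induction m) (simp_all add: nat_pow_def multiplicative_monoid_def ac_simps)

lemma pow_additive: "x [^]\<^bsub>additive_monoid\<^esub> (m::nat) = of_nat m * (x::'a::comm_semiring_1)"
  by (induction m) (simp_all add: nat_pow_def additive_monoid_def algebra_simps)

text \<open>The subsemiring generated by \<open>E\<close> consists of the sums of products of elements of \<open>E\<close>, so it
  arises by closing \<open>E\<close> first under multiplication and then under addition. Each closure is
  generated by torsion elements; for the addition this holds since \<open>2\<^sup>i x = 2\<^sup>j x\<close>.\<close>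

lemma subsemiring_of_torsion_finite:
  fixes E :: "'a::comm_semiring_1 set"
  assumes "finite E" and "i < j" and torsion: "\<And>x::'a. x ^ i = x ^ j"
  obtains T where "finite T" "E \<subseteq> T" "0 \<in> T" "1 \<in> T"
    "\<And>a b. \<lbrakk>a \<in> T; b \<in> T\<rbrakk> \<Longrightarrow> a + b \<in> T" "\<And>a b. \<lbrakk>a \<in> T; b \<in> T\<rbrakk> \<Longrightarrow> a * b \<in> T"
proof -
  interpret M: Group.comm_monoid "multiplicative_monoid :: 'a monoid"
    by (rule comm_monoid_multiplicative)
  interpret A: Group.comm_monoid "additive_monoid :: 'a monoid"
    by (rule comm_monoid_additive)
  define M where "M = monoid_generate multiplicative_monoid E"
  define T where "T = monoid_generate additive_monoid M"
  have M_mult: "x * y \<in> M" if "x \<in> M" "y \<in> M" for x y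
    using monoid_generate.mult[of _ multiplicative_monoid E] that
    by (simp add: M_def multiplicative_monoid_def)
  have T_add: "x + y \<in> T" if "x \<in> T" "y \<in> T" for x y
    using monoid_generate.mult[of _ additive_monoid M] that
    by (simp add: T_def additive_monoid_def)
  have T_zero: "0 \<in> T"
    using monoid_generate.one[of additive_monoid M] by (simp add: T_def additive_monoid_def)
  have T_induct: "P a" if "a \<in> T" "P 0" "\<And>x. x \<in> M \<Longrightarrow> P x" "\<And>x y. P x \<Longrightarrow> P y \<Longrightarrow> P (x + y)"
    for P a
    using that(1) unfolding T_def
    by induction (use that in \<open>auto simp: additive_monoid_def\<close>)
  have "finite M"
    unfolding M_def
  proof (rule M.finite_monoid_generate)
    show "finite (monoid_generate multiplicative_monoid {x})" for x :: 'a
      using \<open>i < j\<close> torsion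
      by (intro M.finite_monoid_generate_singleton[where i = i and j = j])
        (simp_all only: pow_multiplicative, simp_all add: multiplicative_monoid_def)
  qed (simp_all add: multiplicative_monoid_def \<open>finite E\<close>)
  then have "finite T"
    unfolding T_def
  proof (rule A.finite_monoid_generate)
    fix x :: 'a
    \<comment> \<open>The multiplicative torsion of the element \<open>2\<close> is additive torsion of \<open>1\<close>, hence of \<open>x\<close>.\<close>
    have "of_nat (2 ^ i) * x = of_nat (2 ^ j) * x"
      using torsion[of 2] by simp
    then show "finite (monoid_generate additive_monoid {x})"
      using \<open>i < j\<close>
      by (intro A.finite_monoid_generate_singleton[where i = "2 ^ i" and j = "2 ^ j"])
        (simp_all only: pow_additive, simp_all add: additive_monoid_def)
  qed (simp add: additive_monoid_def)
  moreover have "M \<subseteq> T"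
    by (auto simp: T_def intro: monoid_generate.incl)
  moreover have "E \<subseteq> M"
    by (auto simp: M_def intro: monoid_generate.incl)
  moreover have "1 \<in> M"
    using monoid_generate.one[of multiplicative_monoid E]
    by (simp add: M_def multiplicative_monoid_def)
  moreover have "a * b \<in> T" if a: "a \<in> T" and b: "b \<in> T" for a b
    using a
  proof (rule T_induct)
    fix x assume "x \<in> M"
    show "x * b \<in> T"
      using b
    proof (rule T_induct)
      show "x * y \<in> T" if "y \<in> M" for y
        using M_mult[OF \<open>x \<in> M\<close> that] \<open>M \<subseteq> T\<close> by blast
    qed (simp_all add: T_zero T_add distrib_left)
  qed (simp_all add: T_zero T_add distrib_right)
  ultimately show ?thesis
    using that[of T] T_zero T_add by blast
qed

section \<open>Word values\<close>

lemma (in Group.monoid) monoid_word_value_closed: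
  assumes "\<phi> \<in> UNIV \<rightarrow> carrier G"
  shows "monoid_word_value G \<phi> w \<in> carrier G"
  using assms by (induction w) auto

lemma (in Group.monoid) semigroup_word_value_eq:
  assumes "\<phi> \<in> UNIV \<rightarrow> carrier G" "w \<noteq> []"
  shows "semigroup_word_value G \<phi> w = monoid_word_value G \<phi> w"
  using assms(2)
proof (induction w rule: induct_list012)
  case (2 x)
  then show ?case using assms(1) by (simp add: Pi_iff)
qed simp_all

lemma (in Group.monoid) satisfies_semigroup_identity_iff:
  "satisfies_semigroup_identity G u v \<longleftrightarrow> u \<noteq> [] \<and> v \<noteq> [] \<and> satisfies_monoid_identity G u v"
  unfolding satisfies_semigroup_identity_def satisfies_monoid_identity_def
  using semigroup_word_value_eq by auto

lemma (in Group.monoid) monoid_word_value_append: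
  assumes "\<phi> \<in> UNIV \<rightarrow> carrier G"
  shows "monoid_word_value G \<phi> (u @ v) = monoid_word_value G \<phi> u \<otimes> monoid_word_value G \<phi> v"
  using assms by (induction u) (auto simp: m_assoc monoid_word_value_closed Pi_iff)

lemma (in Group.monoid) monoid_generate_word_value:
  assumes "\<phi> \<in> UNIV \<rightarrow> carrier G" "a \<in> monoid_generate G (\<phi> ` K)"
  shows "a \<in> monoid_word_value G \<phi> ` lists K"
  using assms(2)
proof induction
  case one
  have "\<one> = monoid_word_value G \<phi> []" by simp
  then show ?case by blast
next
  case (incl a)
  then obtain x where "x \<in> K" "a = \<phi> x" by blast
  then have "a = monoid_word_value G \<phi> [x]" "[x] \<in> lists K"
    using assms(1) by (auto simp: Pi_iff)
  then show ?case by blast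
next
  case (mult a b)
  then obtain u v where "u \<in> lists K" "v \<in> lists K"
    "a = monoid_word_value G \<phi> u" "b = monoid_word_value G \<phi> v" by blast
  then have "a \<otimes> b = monoid_word_value G \<phi> (u @ v)" "u @ v \<in> lists K"
    using monoid_word_value_append[OF assms(1)] by auto
  then show ?case by blast
qed

lemma (in semigroup_structure) semigroup_word_value_closed:
  assumes "\<phi> \<in> UNIV \<rightarrow> carrier G" "w \<noteq> []"
  shows "semigroup_word_value G \<phi> w \<in> carrier G"
  using assms(2)
  by (induction w rule: induct_list012) (use assms(1) in \<open>auto intro!: m_closed\<close>)

lemma (in semigroup_structure) semigroup_word_value_append:
  assumes "\<phi> \<in> UNIV \<rightarrow> carrier G" "u \<noteq> []" "v \<noteq> []"
  shows "semigroup_word_value G \<phi> (u @ v) = semigroup_word_value G \<phi> u \<otimes> semigroup_word_value G \<phi> v"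
  using assms(2)
proof (induction u rule: induct_list012)
  case (2 x)
  then show ?case using assms(3) by (cases v) auto
next
  case (3 x y u)
  have "\<phi> x \<in> carrier G" using assms(1) by auto
  with 3 show ?case
    using semigroup_word_value_closed[OF assms(1), of "y # u"]
      semigroup_word_value_closed[OF assms(1,3)] by (simp add: m_assoc)
qed simp

lemma (in semigroup_structure) semigroup_generate_word_value:
  assumes "\<phi> \<in> UNIV \<rightarrow> carrier G" "a \<in> semigroup_generate G (\<phi> ` K)"
  shows "a \<in> semigroup_word_value G \<phi> ` (lists K - {[]})"
  using assms(2)
proof induction
  case (incl a)
  then obtain x where "x \<in> K" "a = \<phi> x" by blast
  then have "a = semigroup_word_value G \<phi> [x]" "[x] \<in> lists K - {[]}"
    by auto
  then show ?case by blast
next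
  case (mult a b)
  then obtain u v where "u \<in> lists K - {[]}" "v \<in> lists K - {[]}"
    "a = semigroup_word_value G \<phi> u" "b = semigroup_word_value G \<phi> v" by blast
  then have "a \<otimes> b = semigroup_word_value G \<phi> (u @ v)" "u @ v \<in> lists K - {[]}"
    using semigroup_word_value_append[OF assms(1)] by auto
  then show ?case by blast
qed

section \<open>Identities of the upper triangular matrices\<close>

lemma upper_triangular_mult:
  fixes A B :: "'a::semiring_0 mat"
  assumes "A \<in> carrier_mat n n" "B \<in> carrier_mat n n" "upper_triangular A" "upper_triangular B"
  shows "upper_triangular (A * B)"
proof (rule upper_triangularI)
  fix p q assume "q < p" "p < dim_row (A * B)"
  moreover have "A $$ (p, r) * B $$ (r, q) = 0" if "r < n" for r
  proof (cases "r < p")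
    case True
    then have "A $$ (p, r) = 0" using assms calculation by auto
    then show ?thesis by simp
  next
    case False
    then have "B $$ (r, q) = 0" using assms calculation that by auto
    then show ?thesis by simp
  qed
  ultimately show "(A * B) $$ (p, q) = 0"
    using assms(1,2) by (simp add: scalar_prod_def)
qed

lemma monoid_UT: "Group.monoid (UT n :: 'a::comm_semiring_1 mat monoid)"
  by unfold_locales (auto simp: UT_def upper_triangular_mult)

text \<open>Scalar matrices carry the multiplicative monoid into \<open>UT n\<close>.\<close>

lemma multiplicative_identity_of_UT_identity:
  assumes "n \<ge> 1" and "satisfies_monoid_identity (UT n :: 'a::comm_semiring_1 mat monoid) u v"
  shows "satisfies_monoid_identity (multiplicative_monoid :: 'a monoid) u v"
  unfolding satisfies_monoid_identity_def
proof
  fix \<psi> :: "nat \<Rightarrow> 'a"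
  let ?\<phi> = "\<lambda>x. \<psi> x \<cdot>\<^sub>m 1\<^sub>m n"
  have scalar: "monoid_word_value (UT n) ?\<phi> w
      = monoid_word_value multiplicative_monoid \<psi> w \<cdot>\<^sub>m 1\<^sub>m n" for w
    by (induction w) (auto simp: UT_def multiplicative_monoid_def ac_simps intro!: eq_matI)
  have "?\<phi> \<in> UNIV \<rightarrow> carrier (UT n)"
    by (auto simp: UT_def)
  then have "monoid_word_value (UT n) ?\<phi> u = monoid_word_value (UT n) ?\<phi> v"
    using assms(2) unfolding satisfies_monoid_identity_def by blast
  then have "(monoid_word_value multiplicative_monoid \<psi> u \<cdot>\<^sub>m 1\<^sub>m n) $$ (0, 0)
      = (monoid_word_value multiplicative_monoid \<psi> v \<cdot>\<^sub>m 1\<^sub>m n) $$ (0, 0)"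
    unfolding scalar by simp
  then show "monoid_word_value multiplicative_monoid \<psi> u = monoid_word_value multiplicative_monoid \<psi> v"
    using assms(1) by simp
qed

text \<open>The entries of the value of a word at generic matrices lie in a finite subsemiring of the
  semiring of functions in the indeterminate entries, and determine the word modulo the
  identities of \<open>UT n\<close>. The representatives are chosen inside an arbitrary set \<open>W\<close> of words because
  semigroup identities require them to be nonempty.\<close>

lemma UT_words_finite_index:
  fixes W :: "nat list set"
  assumes "satisfies_torsion_identity TYPE('a::comm_semiring_1)" "finite K" "W \<subseteq> lists K"
  obtains R where "finite R" "R \<subseteq> W"
    "\<And>u. u \<in> W \<Longrightarrow> \<exists>v\<in>R. satisfies_monoid_identity (UT n :: 'a mat monoid) u v"
proof -
  obtain i j where "i < j" and torsion: "\<And>x::'a. x ^ i = x ^ j"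
    using assms(1) unfolding satisfies_torsion_identity_def by blast
  \<comment> \<open>A point \<open>\<psi>\<close> assigns a value to each entry \<open>(p, q)\<close> of the matrix for each letter \<open>x\<close>; the
    indeterminates are the coordinate functions on these points. Every assignment of matrices in
    \<open>UT n\<close> to the letters is a specialisation \<open>gen \<psi>\<close>.\<close>
  define entry :: "nat \<Rightarrow> nat \<Rightarrow> nat \<Rightarrow> (nat \<Rightarrow> nat \<Rightarrow> nat \<Rightarrow> 'a) \<Rightarrow> 'a"
    where "entry x p q = (\<lambda>\<psi>. \<psi> x p q)" for x p q
  define gen :: "(nat \<Rightarrow> nat \<Rightarrow> nat \<Rightarrow> 'a) \<Rightarrow> nat \<Rightarrow> 'a mat"
    where "gen \<psi> x = mat n n (\<lambda>(p, q). \<psi> x p q)" for \<psi> x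
  define val where "val w = (\<lambda>(p, q) \<psi>. monoid_word_value (UT n) (gen \<psi>) w $$ (p, q))" for w
  let ?I = "{..<n} \<times> {..<n}"
  let ?E = "(\<lambda>(x, p, q). entry x p q) ` (K \<times> ?I)"
  have pow_apply: "(f ^ m) \<psi> = f \<psi> ^ m" for f :: "(nat \<Rightarrow> nat \<Rightarrow> nat \<Rightarrow> 'a) \<Rightarrow> 'a" and m \<psi>
    by (induction m) auto
  have "finite ?E"
    using \<open>finite K\<close> by simp
  moreover have "f ^ i = f ^ j" for f :: "(nat \<Rightarrow> nat \<Rightarrow> nat \<Rightarrow> 'a) \<Rightarrow> 'a"
    by (rule ext) (simp only: pow_apply torsion)
  ultimately obtain T where T: "finite T" "?E \<subseteq> T" "0 \<in> T" "1 \<in> T"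
    "\<And>a b. \<lbrakk>a \<in> T; b \<in> T\<rbrakk> \<Longrightarrow> a + b \<in> T" "\<And>a b. \<lbrakk>a \<in> T; b \<in> T\<rbrakk> \<Longrightarrow> a * b \<in> T"
    using subsemiring_of_torsion_finite[OF _ \<open>i < j\<close>] by metis
  have T_entry: "entry x p q \<in> T" if "x \<in> K" "p < n" "q < n" for x p q
    using T(2) that by force
  have T_sum: "sum f N \<in> T" if "\<And>r. r \<in> N \<Longrightarrow> f r \<in> T" for f and N :: "nat set"
    using that by (induction N rule: infinite_finite_induct) (auto intro: T)
  have dim: "monoid_word_value (UT n) (gen \<psi>) w \<in> carrier_mat n n" for \<psi> w
    by (induction w) (auto simp: UT_def gen_def)
  have val_Cons: "val (x # w) (p, q) = (\<Sum>r\<in>{0..<n}. entry x p r * val w (r, q))"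
    if "p < n" "q < n" for x w p q
  proof
    fix \<psi>
    have sum_apply: "(\<Sum>r\<in>N. f r) \<psi> = (\<Sum>r\<in>N. f r \<psi>)"
      for N :: "nat set" and f :: "nat \<Rightarrow> (nat \<Rightarrow> nat \<Rightarrow> nat \<Rightarrow> 'a) \<Rightarrow> 'a"
      by (induction N rule: infinite_finite_induct) auto
    show "val (x # w) (p, q) \<psi> = (\<Sum>r\<in>{0..<n}. entry x p r * val w (r, q)) \<psi>"
      using dim[of \<psi> w] that
      by (simp add: sum_apply val_def UT_def gen_def entry_def scalar_prod_def)
  qed
  have val_T: "val w (p, q) \<in> T" if "w \<in> lists K" "p < n" "q < n" for w p q
    using that
  proof (induction w arbitrary: p q rule: list.induct)
    case Nil
    have "val [] (p, q) = (if p = q then 1 else 0)"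
      using Nil by (auto simp: val_def UT_def)
    then show ?case using T by simp
  next
    case (Cons x w)
    then show ?case by (auto simp: val_Cons intro!: T_sum T(6) T_entry)
  qed
  define sig where "sig w = restrict (val w) ?I" for w
  have "sig ` W \<subseteq> ?I \<rightarrow>\<^sub>E T"
    using val_T assms(3) by (force simp: sig_def PiE_iff)
  then have finite_sig: "finite (sig ` W)"
    by (rule finite_subset) (simp add: finite_PiE T)
  then obtain R where R: "R \<subseteq> W" "finite R"
    "sig ` W = sig ` R"
    using finite_subset_image[OF finite_sig subset_refl] by blast
  have "satisfies_monoid_identity (UT n :: 'a mat monoid) u v"
    if "sig u = sig v" for u v
    unfolding satisfies_monoid_identity_def
  proof
    fix \<phi> :: "nat \<Rightarrow> 'a mat" assume "\<phi> \<in> UNIV \<rightarrow> carrier (UT n)"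
    then have "dim_row (\<phi> x) = n" "dim_col (\<phi> x) = n" for x
      by (auto simp: UT_def Pi_iff)
    then have \<phi>: "gen (\<lambda>x p q. \<phi> x $$ (p, q)) = \<phi>" (is "gen ?\<psi> = \<phi>")
      unfolding gen_def by (intro ext eq_matI) auto
    have "val u (p, q) ?\<psi> = val v (p, q) ?\<psi>" if "p < n" "q < n" for p q
      using fun_cong[OF \<open>sig u = sig v\<close>, of "(p, q)"] that by (simp add: sig_def)
    then show "monoid_word_value (UT n) \<phi> u = monoid_word_value (UT n) \<phi> v"
      using dim[of ?\<psi> u] dim[of ?\<psi> v] unfolding \<phi> val_def by (intro eq_matI) (auto simp: \<phi>)
  qed
  moreover have "\<exists>v\<in>R. sig u = sig v" if "u \<in> W" for u
    using imageI[OF that, of sig] unfolding R(3) by blast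
  ultimately show ?thesis
    using that[OF R(2,1)] by blast
qed

section \<open>Torsion implies local finiteness\<close>

lemma locally_finite_semigroup_variety_UT:
  assumes "satisfies_torsion_identity TYPE('a::comm_semiring_1)"
  shows "locally_finite_semigroup_class
    (semigroup_variety (UT n :: 'a mat monoid) :: 'b monoid set)"
  unfolding locally_finite_semigroup_class_def
proof (intro ballI impI)
  fix G :: "'b monoid"
  assume G: "G \<in> semigroup_variety (UT n :: 'a mat monoid)"
    and "\<exists>X. finite X \<and> X \<subseteq> carrier G \<and> semigroup_generate G X = carrier G"
  then obtain X where X: "finite X" "X \<subseteq> carrier G" "semigroup_generate G X = carrier G"
    by blast
  interpret semigroup_structure G
    using G by (simp add: semigroup_variety_def)
  show "finite (carrier G)"
  proof (cases "carrier G = {}")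
    case False
    have "b \<notin> semigroup_generate G {}" for b
    proof
      assume "b \<in> semigroup_generate G {}"
      then show False by induction auto
    qed
    then have "X \<noteq> {}" using False X(3) by auto
    define \<phi> :: "nat \<Rightarrow> 'b" where "\<phi> = from_nat_into X"
    have "range \<phi> = X"
      using \<open>X \<noteq> {}\<close> X(1) unfolding \<phi>_def by (intro range_from_nat_into) (auto intro: countable_finite)
    then obtain K where K: "finite K" "\<phi> ` K = X"
      using X(1) finite_subset_image[of X \<phi> UNIV] by auto
    have \<phi>: "\<phi> \<in> UNIV \<rightarrow> carrier G"
      using \<open>range \<phi> = X\<close> X(2) by auto
    obtain R where R: "finite R" "R \<subseteq> lists K - {[]}"
      "\<And>u. u \<in> lists K - {[]} \<Longrightarrow> \<exists>v\<in>R. satisfies_monoid_identity (UT n :: 'a mat monoid) u v"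
      using UT_words_finite_index[OF assms K(1), of "lists K - {[]}" n] Diff_subset by metis
    have "carrier G \<subseteq> semigroup_word_value G \<phi> ` R"
    proof
      fix a assume "a \<in> carrier G"
      then obtain u where u: "u \<in> lists K - {[]}" "a = semigroup_word_value G \<phi> u"
        using semigroup_generate_word_value[OF \<phi>, of a K] K X by blast
      then obtain v where "v \<in> R" "satisfies_monoid_identity (UT n :: 'a mat monoid) u v"
        using R(3) by blast
      moreover from this have "satisfies_semigroup_identity (UT n :: 'a mat monoid) u v"
        using u R(2) by (auto simp: monoid.satisfies_semigroup_identity_iff[OF monoid_UT])
      then have "satisfies_semigroup_identity G u v"
        using G by (simp add: semigroup_variety_def)
      ultimately show "a \<in> semigroup_word_value G \<phi> ` R"
        using \<phi> u by (auto simp: satisfies_semigroup_identity_def)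
    qed
    then show ?thesis
      using R(1) finite_surj by blast
  qed simp
qed

lemma locally_finite_monoid_variety_UT:
  assumes "satisfies_torsion_identity TYPE('a::comm_semiring_1)"
  shows "locally_finite_monoid_class
    (monoid_variety (UT n :: 'a mat monoid) :: 'b monoid set)"
  unfolding locally_finite_monoid_class_def
proof (intro ballI impI)
  fix G :: "'b monoid"
  assume G: "G \<in> monoid_variety (UT n :: 'a mat monoid)"
    and "\<exists>X. finite X \<and> X \<subseteq> carrier G \<and> monoid_generate G X = carrier G"
  then obtain X where X: "finite X" "X \<subseteq> carrier G" "monoid_generate G X = carrier G"
    by blast
  interpret Group.monoid G
    using G by (simp add: monoid_variety_def)
  \<comment> \<open>The unit is added because an assignment needs a value even if \<open>X\<close> is empty; the letters in
    \<open>K\<close> still name only the generators.\<close>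
  define \<phi> :: "nat \<Rightarrow> 'b" where "\<phi> = from_nat_into (insert \<one>\<^bsub>G\<^esub> X)"
  have range_\<phi>: "range \<phi> = insert \<one>\<^bsub>G\<^esub> X"
    using X(1) unfolding \<phi>_def by (intro range_from_nat_into) (auto intro: countable_finite)
  then obtain K where K: "finite K" "\<phi> ` K = X"
    using X(1) finite_subset_image[of X \<phi> UNIV] by auto
  have \<phi>: "\<phi> \<in> UNIV \<rightarrow> carrier G"
    using X(2) by (simp add: range_\<phi> flip: image_subset_iff_funcset)
  obtain R where R: "finite R" "R \<subseteq> lists K"
    "\<And>u. u \<in> lists K \<Longrightarrow> \<exists>v\<in>R. satisfies_monoid_identity (UT n :: 'a mat monoid) u v"
    using UT_words_finite_index[OF assms K(1), of "lists K" n] subset_refl by metis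
  have "carrier G \<subseteq> monoid_word_value G \<phi> ` R"
  proof
    fix a assume "a \<in> carrier G"
    then obtain u where u: "u \<in> lists K" "a = monoid_word_value G \<phi> u"
      using monoid_generate_word_value[OF \<phi>, of a K] K X by blast
    then obtain v where "v \<in> R" "satisfies_monoid_identity (UT n :: 'a mat monoid) u v"
      using R(3) by blast
    moreover from this have "satisfies_monoid_identity G u v"
      using G by (simp add: monoid_variety_def)
    ultimately show "a \<in> monoid_word_value G \<phi> ` R"
      using \<phi> u by (auto simp: satisfies_monoid_identity_def)
  qed
  then show "finite (carrier G)"
    using R(1) finite_surj by blast
qed

section \<open>Identities beyond commutativity\<close>

lemma count_list_eq_imp_mset_eq: "(\<And>x. count_list u x = count_list v x) \<Longrightarrow> mset u = mset v"
  by (intro multiset_eqI) (simp add: count_mset count_list_eq_length_filter)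

text \<open>Setting every letter except \<open>x\<close> to \<open>1\<close> leaves a power of the value of \<open>x\<close>.\<close>

lemma beyond_commutativity_iff_torsion:
  "satisfies_identity_beyond_commutativity TYPE('a::comm_semiring_1)
    \<longleftrightarrow> satisfies_torsion_identity TYPE('a)"
proof
  assume "satisfies_identity_beyond_commutativity TYPE('a)"
  then obtain u v x where uv: "satisfies_monoid_identity (multiplicative_monoid :: 'a monoid) u v"
    and x: "count_list u x \<noteq> count_list v x"
    unfolding satisfies_identity_beyond_commutativity_def by blast
  have val: "monoid_word_value multiplicative_monoid (\<lambda>y. if y = x then A else 1) w
      = A ^ count_list w x" for A :: 'a and w
    by (induction w) (auto simp: multiplicative_monoid_def)
  have eq: "A ^ count_list u x = A ^ count_list v x" for A :: 'a
    using uv unfolding satisfies_monoid_identity_def val[symmetric]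
    by (auto simp: multiplicative_monoid_def)
  show "satisfies_torsion_identity TYPE('a)"
    unfolding satisfies_torsion_identity_def using x eq by (metis nat_neq_iff)
next
  assume "satisfies_torsion_identity TYPE('a)"
  then obtain i j where "i < j" and torsion: "\<And>A::'a. A ^ i = A ^ j"
    unfolding satisfies_torsion_identity_def by blast
  have val: "monoid_word_value multiplicative_monoid \<phi> (replicate m 0) = (\<phi> 0 :: 'a) ^ m" for \<phi> m
    by (induction m) (auto simp: multiplicative_monoid_def)
  have count: "count_list (replicate m (0::nat)) 0 = m" for m
    by (induction m) auto
  have "satisfies_monoid_identity (multiplicative_monoid :: 'a monoid) (replicate i 0) (replicate j 0)"
    unfolding satisfies_monoid_identity_def val by (simp only: torsion) simp
  then show "satisfies_identity_beyond_commutativity TYPE('a)"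
    unfolding satisfies_identity_beyond_commutativity_def using count \<open>i < j\<close>
    by (metis nat_neq_iff)
qed

text \<open>A copy of the additive monoid of the natural numbers inside the ambient type witnesses the
  failure of local finiteness. Including \<open>0\<close> among the generators makes it finitely generated as a
  semigroup too, so that one structure serves both kinds of variety.\<close>

lemma infinite_two_generated_commutative_monoid:
  assumes "infinite (UNIV :: 'b set)"
  obtains G :: "'b monoid" and X where "Group.monoid G" "infinite (carrier G)"
    "finite X" "X \<subseteq> carrier G" "semigroup_generate G X = carrier G" "monoid_generate G X = carrier G"
    "\<And>u v. mset u = mset v \<Longrightarrow> satisfies_monoid_identity G u v"
proof -
  obtain \<iota> :: "nat \<Rightarrow> 'b" where \<iota>: "inj \<iota>"
    using assms infinite_countable_subset by blast
  define G where "G = \<lparr>carrier = range \<iota>, mult = (\<lambda>a b. \<iota> (inv_into UNIV \<iota> a + inv_into UNIV \<iota> b)), one = \<iota> 0\<rparr>"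
  have [simp]: "inv_into UNIV \<iota> (\<iota> m) = m" for m
    by (simp add: \<iota>)
  have carrier: "carrier G = range \<iota>" and mult: "\<iota> k \<otimes>\<^bsub>G\<^esub> \<iota> m = \<iota> (k + m)" for k m
    by (simp_all add: G_def)
  interpret Group.monoid G
    by unfold_locales (auto simp: G_def add.assoc)
  let ?X = "{\<iota> 0, \<iota> 1}"
  have "\<iota> m \<in> semigroup_generate G ?X" for m
  proof (induction m)
    case (Suc m)
    then show ?case
      using semigroup_generate.mult[OF _ semigroup_generate.incl[of "\<iota> 1" ?X], of "\<iota> m" G]
      by (simp add: mult)
  qed (auto intro: semigroup_generate.incl)
  then have gen: "carrier G \<subseteq> semigroup_generate G ?X"
    by (auto simp: carrier)
  have closed: "monoid_generate G ?X \<subseteq> carrier G"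
    using monoid_generate_closed[of ?X] by (auto simp: carrier)
  have "a \<in> monoid_generate G ?X" if "a \<in> semigroup_generate G ?X" for a
    using that by induction (auto intro: monoid_generate.intros)
  then have sub: "semigroup_generate G ?X \<subseteq> monoid_generate G ?X"
    by blast
  have val: "monoid_word_value G \<phi> w = \<iota> (\<Sum>x\<in>#mset w. inv_into UNIV \<iota> (\<phi> x))" for \<phi> w
    by (induction w) (auto simp: G_def)
  show ?thesis
  proof (rule that[of G ?X])
    show "satisfies_monoid_identity G u v" if "mset u = mset v" for u v
      using that by (simp add: satisfies_monoid_identity_def val)
    show "infinite (carrier G)"
      unfolding carrier using \<iota> by (rule range_inj_infinite)
  qed (use gen closed sub monoid_axioms in \<open>auto simp: carrier\<close>)
qed

theorem theorem4p8:
  fixes n :: nat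
  assumes "n \<ge> 1"
    and "infinite (UNIV :: 'b set)"
  shows
    "(locally_finite_semigroup_class
        (semigroup_variety (UT n :: 'a::comm_semiring_1 mat monoid) :: 'b monoid set)
      \<longleftrightarrow> satisfies_identity_beyond_commutativity TYPE('a))
   \<and> (locally_finite_monoid_class
        (monoid_variety (UT n :: 'a mat monoid) :: 'b monoid set)
      \<longleftrightarrow> satisfies_identity_beyond_commutativity TYPE('a))
   \<and> (satisfies_identity_beyond_commutativity TYPE('a) \<longleftrightarrow> satisfies_torsion_identity TYPE('a))"
proof -
  obtain G :: "'b monoid" and X where G: "Group.monoid G" "infinite (carrier G)"
    and X: "finite X" "X \<subseteq> carrier G" "semigroup_generate G X = carrier G" "monoid_generate G X = carrier G"
    and comm: "\<And>u v. mset u = mset v \<Longrightarrow> satisfies_monoid_identity G u v"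
    using infinite_two_generated_commutative_monoid[OF assms(2)] by blast
  interpret Group.monoid G by (rule G)
  have not_locally_finite:
    "\<not> locally_finite_semigroup_class (semigroup_variety (UT n :: 'a mat monoid) :: 'b monoid set)
     \<and> \<not> locally_finite_monoid_class (monoid_variety (UT n :: 'a mat monoid) :: 'b monoid set)"
    if none: "\<not> satisfies_identity_beyond_commutativity TYPE('a)"
  proof -
    have identity: "satisfies_monoid_identity G u v"
      if "satisfies_monoid_identity (UT n :: 'a mat monoid) u v" for u v
    proof -
      have "count_list u x = count_list v x" for x
        using multiplicative_identity_of_UT_identity[OF assms(1) that] none
        by (auto simp: satisfies_identity_beyond_commutativity_def)
      then show ?thesis by (intro comm count_list_eq_imp_mset_eq)
    qed
    have "G \<in> monoid_variety (UT n :: 'a mat monoid)"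
      using identity G(1) by (simp add: monoid_variety_def)
    moreover have "semigroup_structure G"
      by unfold_locales (simp_all add: m_assoc)
    then have "G \<in> semigroup_variety (UT n :: 'a mat monoid)"
      using identity by (simp add: semigroup_variety_def satisfies_semigroup_identity_iff
          monoid.satisfies_semigroup_identity_iff[OF monoid_UT])
    ultimately show ?thesis
      unfolding locally_finite_semigroup_class_def locally_finite_monoid_class_def
      using G(2) X by blast
  qed
  then show ?thesis
    using locally_finite_semigroup_variety_UT[where 'a = 'a and 'b = 'b and n = n]
      locally_finite_monoid_variety_UT[where 'a = 'a and 'b = 'b and n = n]
    unfolding beyond_commutativity_iff_torsion by blast
qed

end
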